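(* Let $G=(\mathcal N,\mathcal L,c)$ be a weighted graph and let $(i,j)\in\mathcal L$ be a link. Let $\kappa^{(OR)}_{ij}$ be the Ollivier-Ricci curvature of $(i,j)$ with respect to the resistance distance $\omega$ and the lazy random walk $\mu_{t,x}=(I-Qt)\mathbf e_x$, and let $\kappa_{ij}$ be the link resistance curvature of $(i,j)$. Then $$\kappa^{(OR)}_{ij}\ \geq\ \kappa_{ij},$$ with equality if $(i,j)$ is a cut link.
   Context: A weighted graph $G=(\mathcal N,\mathcal L,c)$ is a finite simple undirected graph without self-loops, with $n$ nodes $\mathcal N$, links $\mathcal L$, and positive link weights $c_{ij}=c_{ji}>0$ for $(i,j)\in\mathcal L$; write $i\sim j$ if $(i,j)\in\mathcal L$. The weighted degree is $k_i=\sum_{j\sim i}c_{ij}$, and $k_{\max}=\max_i k_i$. The Laplacian $Q$ is the $n\times n$ matrix with $Q_{ij}=-c_{ij}$ if $i\sim j$, $Q_{ii}=k_i$, and $0$ otherwise; $Q^\dagger$ is its Moore-Penrose pseudoinverse. The effective resistance (resistance distance) between nodes $i,j$ in the same connected component is $\omega_{ij}=(\mathbf e_i-\mathbf e_j)^TQ^\dagger(\mathbf e_i-\mathbf e_j)$, where $\mathbf e_i$ is the $i$-th unit vector; it is a metric on each component. The node resistance curvature is $p_i=1-\frac12\sum_{j\sim i}c_{ij}\omega_{ij}$, and the link resistance curvature of $(i,j)\in\mathcal L$ is $\kappa_{ij}=\frac{2(p_i+p_j)}{\omega_{ij}}$. A cut link is a link whose removal increases the number of connected components of $G$. For $0\le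 t\le k_{\max}^{-1}$ the lazy random walk is given by the probability distributions $\mu_{t,i}$ on $\mathcal N$ with $\mu_{t,i}(i)=1-tk_i$, $\mu_{t,i}(j)=c_{ij}t$ if $j\sim i$, and $0$ otherwise, i.e. as a vector $(I-Qt)\mathbf e_i$. It is supported on the connected component of $i$. For nodes $i,j$ in the same component, the 1-Wasserstein distance with respect to $\omega$ is $$W_1(\mu_{t,i},\mu_{t,j})=\min_P\sum_{x,y}P_{xy}\,\omega_{xy},$$ with $x,y$ ranging over the nodes of that component and the minimum over all entrywise nonnegative matrices $P$ with marginals $\sum_yP_{xy}=\mu_{t,i}(x)$ and $\sum_xP_{xy}=\mu_{t,j}(y)$. The Ollivier-Ricci curvature (in the limit form of Lin, Lu and Yau) is $$\kappa^{(OR)}_{ij}=\lim_{t\to0^+}\frac1t\left(1-\frac{W_1(\mu_{t,i},\mu_{t,j})}{\omega_{ij}}\right).$$ *)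

theory Defs
  imports "HOL-Analysis.Analysis"
begin

definition is_pseudoinverse :: "real^'n^'m \<Rightarrow> real^'m^'n \<Rightarrow> bool" where
  "is_pseudoinverse A X \<longleftrightarrow>
     A ** X ** A = A \<and> X ** A ** X = X \<and>
     transpose (A ** X) = A ** X \<and> transpose (X ** A) = X ** A"

definition pseudoinverse :: "real^'n^'m \<Rightarrow> real^'m^'n" where
  "pseudoinverse A = (THE X. is_pseudoinverse A X)"

lemma is_pseudoinverse_unique:
  assumes X: "is_pseudoinverse A X" and Y: "is_pseudoinverse A Y"
  shows "X = Y"
proof -
  note x = X[unfolded is_pseudoinverse_def] and y = Y[unfolded is_pseudoinverse_def]
  have "A ** X = (A ** Y) ** (A ** X)"
    using y by (simp add: matrix_mul_assoc)
  also have "\<dots> = transpose ((A ** X) ** (A ** Y))"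
    using x y by (simp add: matrix_transpose_mul)
  also have "(A ** X) ** (A ** Y) = A ** Y"
    using x by (simp add: matrix_mul_assoc)
  finally have 1: "A ** X = A ** Y" using y by simp
  have "X ** A = (X ** A) ** (Y ** A)"
    using y by (metis matrix_mul_assoc)
  also have "\<dots> = transpose ((Y ** A) ** (X ** A))"
    using x y by (simp add: matrix_transpose_mul)
  also have "(Y ** A) ** (X ** A) = Y ** A"
    using x by (metis matrix_mul_assoc)
  finally have 2: "X ** A = Y ** A" using y by simp
  have "X = X ** (A ** X)" using x by (simp add: matrix_mul_assoc)
  also have "\<dots> = (Y ** A) ** Y" using 1 2 by (simp add: matrix_mul_assoc)
  finally show ?thesis using y by simp
qed

lemma pseudoinverse_ex: "\<exists>X. is_pseudoinverse (A :: real^'n^'m) X"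
proof -
  let ?f = "\<lambda>x. A *v x" and ?g = "\<lambda>y. transpose A *v y"
  have adj: "(A *v x) \<bullet> y = x \<bullet> (transpose A *v y)" for x y
    by (metis dot_lmul_matrix inner_commute transpose_matrix_vector)
  have lin: "linear ?f" "linear ?g" by (rule matrix_vector_mul_linear)+
  have sub: "subspace (range ?f)" "subspace (range ?g)"
    using lin by (auto intro: linear_subspace_image)
  have ex: "\<exists>x. x \<in> range ?g \<and> transpose A *v (y - A *v x) = 0" for y
  proof -
    obtain p q where p: "p \<in> range ?f" "\<And>w. w \<in> range ?f \<Longrightarrow> orthogonal q w" "y = p + q"
      using orthogonal_subspace_decomp_exists[of "range ?f" y] sub(1)
      by (metis span_eq_iff)
    obtain u where u: "p = A *v u" using p by auto
    obtain s k where s: "s \<in> range ?g" "\<And>w. w \<in> range ?g \<Longrightarrow> orthogonal k w" "u = s + k"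
      using orthogonal_subspace_decomp_exists[of "range ?g" u] sub(2)
      by (metis span_eq_iff)
    have "(A *v k) \<bullet> (A *v k) = 0"
      using s(2) by (simp add: adj orthogonal_def)
    then have "A *v s = p" using u s(3) by (simp add: matrix_vector_right_distrib)
    then have "y - A *v s = q" using p by simp
    moreover have "q \<bullet> (A *v (transpose A *v q)) = 0"
      using p(2)[of "A *v (transpose A *v q)"] by (auto simp: orthogonal_def)
    then have "(transpose A *v q) \<bullet> (transpose A *v q) = 0"
      using adj[of "transpose A *v q" q] by (simp only: inner_commute)
    then have "transpose A *v q = 0" by (simp only: inner_eq_zero_iff)
    ultimately have "transpose A *v (y - A *v s) = 0" by (simp only:)
    with s(1) show ?thesis by blast
  qed
  then obtain h where h: "\<And>y. h y \<in> range ?g" "\<And>y. transpose A *v (y - A *v h y) = 0"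
    by metis
  have ker: "A *v x = 0" if "transpose A *v (A *v x) = 0" for x
    using that adj[of x "A *v x"] by simp
  have uniq: "x = h y" if x: "x \<in> range ?g" "transpose A *v (y - A *v x) = 0" for x y
  proof -
    have "transpose A *v (A *v (x - h y)) = 0"
      using x(2) h(2)[of y] by (simp add: matrix_vector_mult_diff_distrib)
    then have 0: "A *v (x - h y) = 0" by (rule ker)
    obtain s where s: "x - h y = transpose A *v s"
      using subspace_diff[OF sub(2) x(1) h(1)[of y]] by auto
    have "(x - h y) \<bullet> (x - h y) = (A *v (x - h y)) \<bullet> s"
      unfolding adj s[symmetric] ..
    then show ?thesis using 0 by simp
  qed
  have lh: "linear h"
  proof (rule linearI)
    show "h (a + b) = h a + h b" for a b
    proof (rule uniq[symmetric])
      show "h a + h b \<in> range ?g" using subspace_add[OF sub(2) h(1) h(1)] .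
      have "transpose A *v (a + b - A *v (h a + h b))
          = transpose A *v (a - A *v h a) + transpose A *v (b - A *v h b)"
        by (simp add: matrix_vector_right_distrib matrix_vector_mult_diff_distrib)
      then show "transpose A *v (a + b - A *v (h a + h b)) = 0" using h(2) by simp
    qed
    show "h (r *\<^sub>R b) = r *\<^sub>R h b" for r b
    proof (rule uniq[symmetric])
      show "r *\<^sub>R h b \<in> range ?g" using subspace_scale[OF sub(2) h(1)] .
      have "transpose A *v (r *\<^sub>R b - A *v (r *\<^sub>R h b)) = r *\<^sub>R (transpose A *v (b - A *v h b))"
        by (simp add: matrix_vector_mult_diff_distrib matrix_vector_mult_scaleR scaleR_right_diff_distrib)
      then show "transpose A *v (r *\<^sub>R b - A *v (r *\<^sub>R h b)) = 0" using h(2) by simp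
    qed
  qed
  define X where "X = matrix h"
  have X: "X *v y = h y" for y using lh by (simp add: X_def matrix_works)
  have inner_ker: "v \<bullet> u = 0" if "u \<in> range ?g" "A *v v = 0" for u v
    using that adj[of v] by auto
  have AhA: "A *v h (A *v w) = A *v w" for w
  proof -
    have "transpose A *v (A *v (w - h (A *v w))) = 0"
      using h(2)[of "A *v w"] by (simp add: matrix_vector_mult_diff_distrib)
    from ker[OF this] show ?thesis by (simp add: matrix_vector_mult_diff_distrib)
  qed
  have s1: "(A *v h y) \<bullet> z = (A *v h y) \<bullet> (A *v h z)" for y z
    using h(2)[of z] adj[of "h y" "z - A *v h z"] by (simp add: inner_diff_right)
  have s2: "h (A *v w) \<bullet> v = h (A *v w) \<bullet> h (A *v v)" for v w
    using inner_ker[OF h(1)[of "A *v w"], of "v - h (A *v v)"] AhA[of v]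
    by (simp add: matrix_vector_mult_diff_distrib inner_diff_right inner_commute)
  have sym: "transpose M = M" if "\<And>x y. (M *v x) \<bullet> y = x \<bullet> (M *v y)" for M :: "real^'k^'k"
  proof -
    have "(transpose M *v x) \<bullet> y = (M *v x) \<bullet> y" for x y
      using that by (metis dot_lmul_matrix transpose_matrix_vector inner_commute)
    then have "transpose M *v x = M *v x" for x by (metis vector_eq_rdot)
    then show ?thesis by (simp add: matrix_eq)
  qed
  have "A ** X ** A = A"
    by (simp add: matrix_eq X AhA flip: matrix_vector_mul_assoc)
  moreover have "X ** A ** X = X"
    by (simp add: matrix_eq X flip: matrix_vector_mul_assoc) (metis uniq h(1) diff_self matrix_vector_mult_0_right)
  moreover have "transpose (A ** X) = A ** X"
    by (rule sym) (metis X s1 inner_commute matrix_vector_mul_assoc)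
  moreover have "transpose (X ** A) = X ** A"
    by (rule sym) (metis X s2 inner_commute matrix_vector_mul_assoc)
  ultimately show ?thesis unfolding is_pseudoinverse_def by blast
qed

lemma is_pseudoinverse_pseudoinverse: "is_pseudoinverse A (pseudoinverse A)"
  unfolding pseudoinverse_def
  using pseudoinverse_ex is_pseudoinverse_unique by (metis theI')

text \<open>The nodes are the elements of a finite type, \<open>L\<close> contains both orientations of every
  link, and the values of \<open>c\<close> outside \<open>L\<close> play no role.\<close>

definition weighted_graph :: "('n::finite \<times> 'n) set \<Rightarrow> ('n \<Rightarrow> 'n \<Rightarrow> real) \<Rightarrow> bool" where
  "weighted_graph L c \<longleftrightarrow> irrefl L \<and> sym L \<and> (\<forall>(i, j) \<in> L. c i j = c j i \<and> c i j > 0)"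

definition weighted_degree :: "('n::finite \<times> 'n) set \<Rightarrow> ('n \<Rightarrow> 'n \<Rightarrow> real) \<Rightarrow> 'n \<Rightarrow> real" where
  "weighted_degree L c i = (\<Sum>j | (i, j) \<in> L. c i j)"

definition laplacian :: "('n::finite \<times> 'n) set \<Rightarrow> ('n \<Rightarrow> 'n \<Rightarrow> real) \<Rightarrow> real^'n^'n" where
  "laplacian L c = (\<chi> i j. if (i, j) \<in> L then - c i j else if i = j then weighted_degree L c i else 0)"

definition effective_resistance ::
    "('n::finite \<times> 'n) set \<Rightarrow> ('n \<Rightarrow> 'n \<Rightarrow> real) \<Rightarrow> 'n \<Rightarrow> 'n \<Rightarrow> real" where
  "effective_resistance L c i j =
     (axis i 1 - axis j 1) \<bullet> (pseudoinverse (laplacian L c) *v (axis i 1 - axis j 1))"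

definition node_resistance_curvature ::
    "('n::finite \<times> 'n) set \<Rightarrow> ('n \<Rightarrow> 'n \<Rightarrow> real) \<Rightarrow> 'n \<Rightarrow> real" where
  "node_resistance_curvature L c i =
     1 - 1/2 * (\<Sum>j | (i, j) \<in> L. c i j * effective_resistance L c i j)"

definition link_resistance_curvature ::
    "('n::finite \<times> 'n) set \<Rightarrow> ('n \<Rightarrow> 'n \<Rightarrow> real) \<Rightarrow> 'n \<Rightarrow> 'n \<Rightarrow> real" where
  "link_resistance_curvature L c i j =
     2 * (node_resistance_curvature L c i + node_resistance_curvature L c j)
       / effective_resistance L c i j"

definition component_of :: "('n \<times> 'n) set \<Rightarrow> 'n \<Rightarrow> 'n set" where
  "component_of L i = {j. (i, j) \<in> L\<^sup>*}"

definition num_components :: "('n::finite \<times> 'n) set \<Rightarrow> nat" where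
  "num_components L = card (range (component_of L))"

definition cut_link :: "('n::finite \<times> 'n) set \<Rightarrow> 'n \<Rightarrow> 'n \<Rightarrow> bool" where
  "cut_link L i j \<longleftrightarrow>
     (i, j) \<in> L \<and> num_components (L - {(i, j), (j, i)}) > num_components L"

definition lazy_walk ::
    "('n::finite \<times> 'n) set \<Rightarrow> ('n \<Rightarrow> 'n \<Rightarrow> real) \<Rightarrow> real \<Rightarrow> 'n \<Rightarrow> real^'n" where
  "lazy_walk L c t i = (mat 1 - t *\<^sub>R laplacian L c) *v axis i 1"

lemma lazy_walk_nth:
  assumes "weighted_graph L c"
  shows "lazy_walk L c t i $ x =
    (if x = i then 1 - t * weighted_degree L c i else if (x, i) \<in> L then t * c x i else 0)"
  using assms
  by (auto simp: lazy_walk_def laplacian_def weighted_graph_def irrefl_def matrix_vector_mult_basis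
      column_def mat_def)

text \<open>Entries of \<open>P\<close> outside \<open>C \<times> C\<close> play no role.\<close>

definition couplings :: "'n::finite set \<Rightarrow> real^'n \<Rightarrow> real^'n \<Rightarrow> (real^'n^'n) set" where
  "couplings C \<mu> \<nu> = {P. (\<forall>x\<in>C. \<forall>y\<in>C. 0 \<le> P $ x $ y) \<and>
     (\<forall>x\<in>C. (\<Sum>y\<in>C. P $ x $ y) = \<mu> $ x) \<and> (\<forall>y\<in>C. (\<Sum>x\<in>C. P $ x $ y) = \<nu> $ y)}"

definition transport_cost :: "'n::finite set \<Rightarrow> ('n \<Rightarrow> 'n \<Rightarrow> real) \<Rightarrow> real^'n^'n \<Rightarrow> real" where
  "transport_cost C d P = (\<Sum>x\<in>C. \<Sum>y\<in>C. P $ x $ y * d x y)"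

definition wasserstein1 ::
    "'n::finite set \<Rightarrow> ('n \<Rightarrow> 'n \<Rightarrow> real) \<Rightarrow> real^'n \<Rightarrow> real^'n \<Rightarrow> real" where
  "wasserstein1 C d \<mu> \<nu> = (INF P \<in> couplings C \<mu> \<nu>. transport_cost C d P)"

text \<open>The infimum in \<open>wasserstein1\<close> is a minimum: for probability distributions on \<open>C\<close>
  the next two lemmas show that it is attained.\<close>

lemma couplings_nonempty:
  fixes C :: "'n::finite set"
  assumes "\<forall>x\<in>C. 0 \<le> \<mu> $ x" "\<forall>x\<in>C. 0 \<le> \<nu> $ x"
    and "(\<Sum>x\<in>C. \<mu> $ x) = 1" "(\<Sum>x\<in>C. \<nu> $ x) = 1"
  shows "couplings C \<mu> \<nu> \<noteq> {}"
proof -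
  have "(\<chi> x y. \<mu> $ x * \<nu> $ y) \<in> couplings C \<mu> \<nu>"
    using assms by (auto simp: couplings_def simp flip: sum_distrib_left sum_distrib_right)
  then show ?thesis by blast
qed

lemma wasserstein1_attained:
  fixes C :: "'n::finite set"
  assumes ne: "couplings C \<mu> \<nu> \<noteq> {}"
  shows "\<exists>P \<in> couplings C \<mu> \<nu>. transport_cost C d P = wasserstein1 C d \<mu> \<nu> \<and>
           (\<forall>P' \<in> couplings C \<mu> \<nu>. transport_cost C d P \<le> transport_cost C d P')"
proof -
  let ?r = "\<lambda>P :: real^'n^'n. (\<chi> x y. if x \<in> C \<and> y \<in> C then P $ x $ y else 0) :: real^'n^'n"
  let ?K = "couplings C \<mu> \<nu> \<inter> {P. \<forall>x y. x \<notin> C \<or> y \<notin> C \<longrightarrow> P $ x $ y = 0}"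
  have r: "?r P \<in> ?K" "transport_cost C d (?r P) = transport_cost C d P"
    if "P \<in> couplings C \<mu> \<nu>" for P
    using that by (auto simp: couplings_def transport_cost_def)
  have closed: "closed ?K"
    unfolding couplings_def Ball_def
    by (intro closed_Int closed_Collect_conj closed_Collect_all closed_Collect_imp open_Collect_const
        closed_Collect_le closed_Collect_eq continuous_intros)
  have bnd: "P \<in> cbox 0 (\<chi> x y. \<bar>\<mu> $ x\<bar>)" if P: "P \<in> ?K" for P
  proof -
    have "0 \<le> P $ x $ y \<and> P $ x $ y \<le> \<bar>\<mu> $ x\<bar>" for x y
    proof (cases "x \<in> C \<and> y \<in> C")
      case True
      then have "P $ x $ y \<le> (\<Sum>y\<in>C. P $ x $ y)"
        using P by (intro member_le_sum) (auto simp: couplings_def)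
      also have "\<dots> = \<mu> $ x" using True P by (auto simp: couplings_def)
      finally show ?thesis using True P by (auto simp: couplings_def)
    qed (use P in auto)
    then show ?thesis by (auto simp: mem_box Basis_vec_def inner_axis)
  qed
  have "bounded ?K" by (rule bounded_subset[OF bounded_cbox]) (use bnd in blast)
  with closed have cpt: "compact ?K" by (simp add: compact_eq_bounded_closed)
  have ne': "?K \<noteq> {}" using ne r(1) by blast
  have cont: "continuous_on ?K (transport_cost C d)"
    unfolding transport_cost_def by (intro continuous_intros)
  obtain P where P: "P \<in> ?K" "\<And>P'. P' \<in> ?K \<Longrightarrow> transport_cost C d P \<le> transport_cost C d P'"
    using continuous_attains_inf[OF cpt ne' cont] by (elim bexE) (rule that, assumption, erule bspec)
  have min: "\<forall>P' \<in> couplings C \<mu> \<nu>. transport_cost C d P \<le> transport_cost C d P'"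
  proof
    fix P' assume "P' \<in> couplings C \<mu> \<nu>"
    then show "transport_cost C d P \<le> transport_cost C d P'"
      using P(2)[OF r(1), of P'] r(2)[of P'] by simp
  qed
  have "wasserstein1 C d \<mu> \<nu> = transport_cost C d P"
    unfolding wasserstein1_def by (rule cInf_eq_minimum) (use P(1) min in auto)
  then show ?thesis using P(1) min by auto
qed

text \<open>The lazy walk is a probability distribution only for \<open>0 \<le> t \<le> 1 / k\<close>, with \<open>k\<close> the
  largest weighted degree; other values of \<open>t\<close> do not affect the limit at \<open>0\<close> from the right.
  For a link \<open>(i, j)\<close> the components of \<open>i\<close> and \<open>j\<close> coincide.\<close>

definition ollivier_ricci_quotient ::
    "('n::finite \<times> 'n) set \<Rightarrow> ('n \<Rightarrow> 'n \<Rightarrow> real) \<Rightarrow> 'n \<Rightarrow> 'n \<Rightarrow> real \<Rightarrow> real" where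
  "ollivier_ricci_quotient L c i j t =
     1 / t * (1 - wasserstein1 (component_of L i) (effective_resistance L c)
                    (lazy_walk L c t i) (lazy_walk L c t j) / effective_resistance L c i j)"

definition ollivier_ricci_curvature ::
    "('n::finite \<times> 'n) set \<Rightarrow> ('n \<Rightarrow> 'n \<Rightarrow> real) \<Rightarrow> 'n \<Rightarrow> 'n \<Rightarrow> real" where
  "ollivier_ricci_curvature L c i j = Lim (at_right 0) (ollivier_ricci_quotient L c i j)"

end

theory Submission
  imports Defs
begin

text \<open>
  Write \<open>Q\<close> for the Laplacian, \<open>\<omega>\<close> for the resistance distance, \<open>p\<close> for the node curvature and
  \<open>W(t)\<close> for the distance between the walks started at the ends of the link \<open>(i, j)\<close>.
  Everything reduces to one explicit transport plan. The walk from \<open>i\<close> sends the mass that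
  it puts on the neighbours of \<open>i\<close> straight to \<open>j\<close>; the mass that the walk from \<open>j\<close> puts on the
  neighbours of \<open>j\<close> comes straight from \<open>i\<close>; what is left goes from \<open>i\<close> to \<open>j\<close>. For small \<open>t\<close>
  this is a coupling, and its cost is exactly \<open>\<omega> i j - 2 t (p i + p j)\<close>, because
  \<open>\<Sum>k\<sim>i. c i k (\<omega> k j - \<omega> i j) = - 2 p i\<close> (\<open>effective_resistance_weighted_sum\<close>).
  Hence the quotient is at least the link resistance curvature for every small \<open>t\<close>.

  The limit exists because \<open>W\<close> is convex in \<open>t\<close> with \<open>W 0 \<le> \<omega> i j\<close>, so that the quotient
  increases as \<open>t\<close> decreases to \<open>0\<close>. It stays bounded because every 1-Lipschitz function
  \<open>f\<close> bounds \<open>W\<close> from below (weak Kantorovich duality); here \<open>f x = \<omega> x j\<close> serves.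

  If \<open>(i, j)\<close> is a cut link, the plan above is optimal. Let \<open>A\<close> be the side of \<open>i\<close>
  after removal of the link. Resistances add up across \<open>j\<close>, that is,
  \<open>\<omega> x y = \<omega> x j + \<omega> j y\<close> for \<open>x\<close> in \<open>A\<close> and \<open>y\<close> outside, so the function equal to \<open>\<omega> x j\<close>
  on \<open>A\<close> and to \<open>- \<omega> j x\<close> off \<open>A\<close> is 1-Lipschitz and drops by exactly
  \<open>\<omega> x y\<close> along every pair \<open>(x, y)\<close> that carries mass (\<open>cut_link_potential\<close>).

  The triangle inequality and additivity across a cut link have a common source. With
  \<open>v = Q\<^sup>\<dagger> (e y - e z)\<close> one has \<open>\<omega> x z + \<omega> z y - \<omega> x y = 2 (v x - v z)\<close>, so the
  first says that \<open>v\<close> is smallest at the sink \<open>z\<close>, and the second that \<open>v\<close> is constant on the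
  far side of the cut. Testing \<open>Q v = e y - e z\<close> against a truncation of \<open>v\<close> proves both
  (\<open>dominated_potential_constant\<close>).
\<close>

section \<open>The Laplacian and its energy form\<close>

lemma link_sym: "weighted_graph L c \<Longrightarrow> (x, y) \<in> L \<Longrightarrow> (y, x) \<in> L"
  unfolding weighted_graph_def by (meson symD)

lemma weight_commute: "weighted_graph L c \<Longrightarrow> (x, y) \<in> L \<Longrightarrow> c x y = c y x"
  unfolding weighted_graph_def by blast

lemma weight_pos: "weighted_graph L c \<Longrightarrow> (x, y) \<in> L \<Longrightarrow> 0 < c x y"
  unfolding weighted_graph_def by blast

lemma no_loop: "weighted_graph L c \<Longrightarrow> (x, x) \<notin> L"
  unfolding weighted_graph_def irrefl_def by blast

lemma connected_sym: "weighted_graph L c \<Longrightarrow> (x, y) \<in> L\<^sup>* \<Longrightarrow> (y, x) \<in> L\<^sup>*"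
  unfolding weighted_graph_def by (meson symD sym_rtrancl)

lemma connected_in_component:
  assumes "weighted_graph L c" and "x \<in> component_of L i" "y \<in> component_of L i"
  shows "(x, y) \<in> L\<^sup>*"
  using assms(2,3) connected_sym[OF assms(1), of i x] rtrancl_trans[of x i L y]
  by (simp add: component_of_def)

lemma laplacian_mult_nth:
  assumes "weighted_graph L c"
  shows "(laplacian L c *v v) $ i = (\<Sum>k | (i, k) \<in> L. c i k * (v $ i - v $ k))"
proof -
  have ii: "(i, i) \<notin> L" using assms by (rule no_loop)
  have "(laplacian L c *v v) $ i =
      (\<Sum>k\<in>UNIV. (if (i, k) \<in> L then - (c i k * v $ k) else 0)
        + (if k = i then weighted_degree L c i * v $ i else 0))"
    unfolding laplacian_def matrix_vector_mult_def using ii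
    by (auto intro!: sum.cong)
  also have "\<dots> = (\<Sum>k | (i, k) \<in> L. - (c i k * v $ k)) + weighted_degree L c i * v $ i"
    by (simp add: sum.distrib sum.If_cases)
  finally show ?thesis
    by (simp add: weighted_degree_def sum_distrib_right right_diff_distrib sum_subtractf sum_negf)
qed

lemma transpose_laplacian:
  assumes "weighted_graph L c"
  shows "transpose (laplacian L c) = laplacian L c"
  using link_sym[OF assms] weight_commute[OF assms]
  by (auto simp: laplacian_def transpose_def vec_eq_iff)

lemma laplacian_adjoint:
  assumes "weighted_graph L c"
  shows "x \<bullet> (laplacian L c *v y) = (laplacian L c *v x) \<bullet> y"
  by (metis assms dot_lmul_matrix transpose_laplacian transpose_matrix_vector)

text \<open>Summation by parts. The sum runs over both orientations of each link, hence the factor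
  one half.\<close>

lemma laplacian_form:
  assumes G: "weighted_graph L c"
  shows "h \<bullet> (laplacian L c *v v) =
    (\<Sum>(a, b)\<in>L. c a b * ((h $ a - h $ b) * (v $ a - v $ b))) / 2"
proof -
  let ?S = "\<Sum>(a, b)\<in>L. c a b * (h $ a * (v $ a - v $ b))"
  have swp: "bij_betw prod.swap L L"
    by (rule bij_betw_byWitness[of _ prod.swap]) (auto intro: link_sym[OF G])
  have 1: "h \<bullet> (laplacian L c *v v) = ?S"
  proof -
    have "h \<bullet> (laplacian L c *v v) =
        (\<Sum>a\<in>UNIV. \<Sum>b | (a, b) \<in> L. c a b * (h $ a * (v $ a - v $ b)))"
      unfolding inner_vec_def laplacian_mult_nth[OF G] inner_real_def
      by (simp add: sum_distrib_left mult_ac)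
    also have "\<dots> = (\<Sum>(a, b)\<in>(SIGMA a:UNIV. {b. (a, b) \<in> L}). c a b * (h $ a * (v $ a - v $ b)))"
      by (rule sum.Sigma) auto
    also have "(SIGMA a:UNIV. {b. (a, b) \<in> L}) = L" by auto
    finally show ?thesis .
  qed
  have 2: "?S = (\<Sum>(a, b)\<in>L. c a b * (h $ b * (v $ b - v $ a)))"
  proof -
    have "?S = (\<Sum>p\<in>L. case prod.swap p of (a, b) \<Rightarrow> c a b * (h $ a * (v $ a - v $ b)))"
      by (rule sum.reindex_bij_betw[OF swp, symmetric])
    also have "\<dots> = (\<Sum>(a, b)\<in>L. c a b * (h $ b * (v $ b - v $ a)))"
      by (intro sum.cong) (auto dest: weight_commute[OF G])
    finally show ?thesis .
  qed
  have "2 * (h \<bullet> (laplacian L c *v v)) = ?S + (\<Sum>(a, b)\<in>L. c a b * (h $ b * (v $ b - v $ a)))"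
    using 1 2 by simp
  also have "\<dots> = (\<Sum>(a, b)\<in>L. c a b * ((h $ a - h $ b) * (v $ a - v $ b)))"
    unfolding sum.distrib[symmetric] by (intro sum.cong) (auto simp: algebra_simps)
  finally show ?thesis by simp
qed

lemma constant_if_energy_nonpos:
  assumes G: "weighted_graph L c"
    and le: "(\<Sum>(a, b)\<in>L. c a b * (h $ a - h $ b)\<^sup>2) \<le> 0"
    and xy: "(x, y) \<in> L\<^sup>*"
  shows "h $ x = h $ y"
proof -
  have nn: "0 \<le> c a b * (h $ a - h $ b)\<^sup>2" if "(a, b) \<in> L" for a b
    using weight_pos[OF G that] by simp
  have "(\<Sum>(a, b)\<in>L. c a b * (h $ a - h $ b)\<^sup>2) = 0"
    using le nn by (intro antisym sum_nonneg) auto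
  then have "\<forall>p\<in>L. (case p of (a, b) \<Rightarrow> c a b * (h $ a - h $ b)\<^sup>2) = 0"
    using nn by (subst (asm) sum_nonneg_eq_0_iff) auto
  then have link: "h $ a = h $ b" if "(a, b) \<in> L" for a b
    using that weight_pos[OF G that] by fastforce
  show ?thesis using xy by induction (auto dest: link)
qed

lemma constant_if_laplacian_zero:
  assumes G: "weighted_graph L c" and "laplacian L c *v h = 0" and "(x, y) \<in> L\<^sup>*"
  shows "h $ x = h $ y"
proof (rule constant_if_energy_nonpos[OF G _ assms(3)])
  show "(\<Sum>(a, b)\<in>L. c a b * (h $ a - h $ b)\<^sup>2) \<le> 0"
    using laplacian_form[OF G, of h h] assms(2) by (simp add: power2_eq_square)
qed

section \<open>Potentials and the resistance metric\<close>

text \<open>The voltages when a unit current enters at \<open>y\<close> and leaves at \<open>z\<close>.\<close>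

definition potential :: "('n::finite \<times> 'n) set \<Rightarrow> ('n \<Rightarrow> 'n \<Rightarrow> real) \<Rightarrow> 'n \<Rightarrow> 'n \<Rightarrow> real^'n" where
  "potential L c y z = pseudoinverse (laplacian L c) *v (axis y 1 - axis z 1)"

text \<open>\<open>Q Q\<^sup>\<dagger>\<close> is the orthogonal projection onto the range of \<open>Q\<close>, so the error
  \<open>w = b - Q Q\<^sup>\<dagger> b\<close> lies in the kernel of \<open>Q\<close> and is orthogonal to that range. The kernel consists
  of functions constant on components, and \<open>b\<close> sums to zero on each of them.\<close>

lemma laplacian_potential:
  assumes G: "weighted_graph L c" and yz: "(y, z) \<in> L\<^sup>*"
  shows "laplacian L c *v potential L c y z = axis y 1 - axis z 1"
proof -
  let ?Q = "laplacian L c"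
  define b :: "real^'a" where "b = axis y 1 - axis z 1"
  let ?X = "pseudoinverse ?Q"
  note X = is_pseudoinverse_pseudoinverse[of ?Q, unfolded is_pseudoinverse_def]
  have "?Q ** (?Q ** ?X) = transpose ?Q ** transpose (?Q ** ?X)"
    using X by (simp add: transpose_laplacian[OF G])
  also have "\<dots> = transpose (?Q ** ?X ** ?Q)" by (rule matrix_transpose_mul[symmetric])
  also have "\<dots> = ?Q" using X by (simp add: transpose_laplacian[OF G])
  finally have QQX: "?Q ** (?Q ** ?X) = ?Q" .
  define w where "w = b - ?Q *v (?X *v b)"
  have "?Q *v w = ?Q *v b - (?Q ** (?Q ** ?X)) *v b"
    by (simp add: w_def matrix_vector_mult_diff_distrib flip: matrix_vector_mul_assoc)
  then have Qw: "?Q *v w = 0" by (simp add: QQX)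
  have "w \<bullet> w = w \<bullet> b - w \<bullet> (?Q *v (?X *v b))"
    by (metis w_def inner_diff_right)
  also have "w \<bullet> (?Q *v (?X *v b)) = 0" by (simp add: laplacian_adjoint[OF G] Qw)
  also have "w \<bullet> b - 0 = w $ y - w $ z" by (simp add: b_def inner_diff_right inner_axis)
  also have "\<dots> = 0" using constant_if_laplacian_zero[OF G Qw yz] by simp
  finally show ?thesis by (simp add: w_def potential_def b_def)
qed

lemma transpose_pseudoinverse_laplacian:
  assumes G: "weighted_graph L c"
  shows "transpose (pseudoinverse (laplacian L c)) = pseudoinverse (laplacian L c)"
proof (rule is_pseudoinverse_unique)
  let ?Q = "laplacian L c"
  let ?X = "pseudoinverse ?Q"
  show X: "is_pseudoinverse ?Q ?X" by (rule is_pseudoinverse_pseudoinverse)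
  then show "is_pseudoinverse ?Q (transpose ?X)"
    unfolding is_pseudoinverse_def
    by (metis matrix_transpose_mul transpose_laplacian[OF G] matrix_mul_assoc transpose_transpose)
qed

lemma effective_resistance_potential:
  "effective_resistance L c x y = potential L c x y $ x - potential L c x y $ y"
  by (simp add: effective_resistance_def potential_def inner_diff_left inner_axis')

lemma effective_resistance_self [simp]: "effective_resistance L c x x = 0"
  by (simp add: effective_resistance_def)

lemma effective_resistance_commute: "effective_resistance L c x y = effective_resistance L c y x"
proof -
  have "axis x 1 - axis y 1 = (- 1) *\<^sub>R (axis y 1 - axis x 1 :: real^'a)" by simp
  then show ?thesis
    unfolding effective_resistance_def
    by (simp only: matrix_vector_mult_scaleR inner_scaleR_left inner_scaleR_right)
qed

text \<open>The polarisation identity for the bilinear form of \<open>Q\<^sup>\<dagger>\<close>, applied to \<open>e x - e z\<close> and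
  \<open>e y - e z\<close>. It turns comparisons between resistances into comparisons between values of one
  potential.\<close>

lemma effective_resistance_gromov_product:
  assumes G: "weighted_graph L c"
  shows "effective_resistance L c x z + effective_resistance L c z y - effective_resistance L c x y
    = 2 * (potential L c y z $ x - potential L c y z $ z)"
proof -
  let ?X = "pseudoinverse (laplacian L c)"
  let ?a = "axis x 1 - axis z 1 :: real^'a" and ?b = "axis y 1 - axis z 1 :: real^'a"
  have sym: "?b \<bullet> (?X *v ?a) = ?a \<bullet> (?X *v ?b)"
    by (metis dot_lmul_matrix inner_commute transpose_matrix_vector transpose_pseudoinverse_laplacian[OF G])
  have ab: "axis x 1 - axis y 1 = ?a - ?b" by simp
  have "effective_resistance L c x y = ?a \<bullet> (?X *v ?a) - ?a \<bullet> (?X *v ?b) - ?b \<bullet> (?X *v ?a) + ?b \<bullet> (?X *v ?b)"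
    unfolding effective_resistance_def ab matrix_vector_mult_diff_distrib[of _ ?a ?b]
      inner_diff_left[of ?a ?b] inner_diff_right[of _ "?X *v ?a"] by simp
  then have "effective_resistance L c x z + effective_resistance L c y z - effective_resistance L c x y
     = 2 * (?a \<bullet> (?X *v ?b))"
    unfolding sym by (simp add: effective_resistance_def)
  then show ?thesis
    by (simp add: effective_resistance_commute[of L c z y] potential_def inner_diff_left inner_axis')
qed

text \<open>The Dirichlet energy of \<open>h\<close> is at most the energy pairing of \<open>h\<close> with the potential, which is
  a positive multiple of \<open>h y - h z\<close>. If this is not positive, \<open>h\<close> has no energy. Truncations of the
  potential satisfy the hypothesis on links.\<close>

lemma dominated_potential_constant:
  assumes G: "weighted_graph L c" and yz: "(y, z) \<in> L\<^sup>*" and xz: "(x, z) \<in> L\<^sup>*"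
    and dom: "\<And>a b. (a, b) \<in> L \<Longrightarrow>
      (h $ a - h $ b)\<^sup>2 \<le> (h $ a - h $ b) * (potential L c y z $ a - potential L c y z $ b)"
    and le: "h $ y \<le> h $ z"
  shows "h $ x = h $ z"
proof (rule constant_if_energy_nonpos[OF G _ xz])
  let ?v = "potential L c y z"
  have "(\<Sum>(a, b)\<in>L. c a b * (h $ a - h $ b)\<^sup>2)
      \<le> (\<Sum>(a, b)\<in>L. c a b * ((h $ a - h $ b) * (?v $ a - ?v $ b)))"
    using dom by (intro sum_mono) (auto intro!: mult_left_mono dest: weight_pos[OF G])
  also have "\<dots> = 2 * (h \<bullet> (laplacian L c *v ?v))"
    by (simp add: laplacian_form[OF G])
  also have "\<dots> = 2 * (h $ y - h $ z)"
    by (simp add: laplacian_potential[OF G yz] inner_diff_right inner_axis)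
  finally show "(\<Sum>(a, b)\<in>L. c a b * (h $ a - h $ b)\<^sup>2) \<le> 0" using le by simp
qed

text \<open>The minimum principle: the part of the potential below its value at the sink is a truncation
  that vanishes at the sink and is nonpositive at the source.\<close>

lemma potential_min_at_sink:
  assumes G: "weighted_graph L c" and yz: "(y, z) \<in> L\<^sup>*" and xz: "(x, z) \<in> L\<^sup>*"
  shows "potential L c y z $ z \<le> potential L c y z $ x"
proof -
  let ?v = "potential L c y z"
  define h :: "real^'a" where "h = (\<chi> x. min (?v $ x - ?v $ z) 0)"
  \<comment> \<open>Clipping at \<open>0\<close> is monotone and 1-Lipschitz.\<close>
  have clip: "(min p 0 - min q 0)\<^sup>2 \<le> (min p 0 - min q 0) * (p - q)" for p q :: real
  proof -
    have "0 \<le> (min p 0 - min q 0) * ((p - q) - (min p 0 - min q 0))"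
      by (cases "p \<le> 0"; cases "q \<le> 0")
        (auto simp: min_def mult_nonpos_nonneg mult_nonneg_nonpos mult_nonpos_nonneg[of q p])
    then show ?thesis by (simp add: power2_eq_square right_diff_distrib)
  qed
  have "h $ x = h $ z"
  proof (rule dominated_potential_constant[OF G yz xz])
    show "(h $ a - h $ b)\<^sup>2 \<le> (h $ a - h $ b) * (?v $ a - ?v $ b)" for a b
      using clip[of "?v $ a - ?v $ z" "?v $ b - ?v $ z"] by (simp add: h_def)
  qed (simp add: h_def)
  then show ?thesis by (simp add: h_def min_def split: if_splits)
qed

lemma effective_resistance_triangle:
  assumes G: "weighted_graph L c" and "(y, z) \<in> L\<^sup>*" and "(x, z) \<in> L\<^sup>*"
  shows "effective_resistance L c x y \<le> effective_resistance L c x z + effective_resistance L c z y"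
  using effective_resistance_gromov_product[OF G, of x z y] potential_min_at_sink[OF assms] by simp

lemma effective_resistance_nonneg:
  assumes G: "weighted_graph L c" and "(x, y) \<in> L\<^sup>*"
  shows "0 \<le> effective_resistance L c x y"
  using effective_resistance_triangle[OF G assms(2) assms(2)]
  by (simp add: effective_resistance_commute[of L c y x])

text \<open>With zero resistance the potential has equal values at source and sink, so its own energy is
  zero. Then it is constant on the component, and no current flows.\<close>

lemma effective_resistance_pos:
  assumes G: "weighted_graph L c" and xy: "(x, y) \<in> L\<^sup>*" and ne: "x \<noteq> y"
  shows "0 < effective_resistance L c x y"
proof -
  let ?v = "potential L c x y"
  have "effective_resistance L c x y \<noteq> 0"
  proof
    assume "effective_resistance L c x y = 0"
    then have eq: "?v $ x = ?v $ y" by (simp add: effective_resistance_potential)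
    have const: "?v $ z = ?v $ y" if "(z, y) \<in> L\<^sup>*" for z
      by (rule dominated_potential_constant[OF G xy that]) (simp_all add: power2_eq_square eq)
    have "(laplacian L c *v ?v) $ x = 0"
      unfolding laplacian_mult_nth[OF G]
    proof (rule sum.neutral, clarify)
      fix k assume "(x, k) \<in> L"
      then have "(k, x) \<in> L" by (rule link_sym[OF G])
      then have "(k, y) \<in> L\<^sup>*" using xy by (rule converse_rtrancl_into_rtrancl)
      then show "c x k * (?v $ x - ?v $ k) = 0" using const[of k] eq by simp
    qed
    then show False by (simp add: laplacian_potential[OF G xy] ne axis_def)
  qed
  then show ?thesis using effective_resistance_nonneg[OF G xy] by simp
qed

text \<open>By the polarisation identity, \<open>\<omega> k i + \<omega> i j - \<omega> k j\<close> is twice a potential difference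
  along the link \<open>(i, k)\<close>, and the weighted sum of these differences is the unit current at \<open>i\<close>.\<close>

lemma effective_resistance_weighted_sum:
  assumes G: "weighted_graph L c" and ij: "(i, j) \<in> L"
  shows "(\<Sum>k | (i, k) \<in> L. c i k * effective_resistance L c k j)
    = weighted_degree L c i * effective_resistance L c i j - 2 * node_resistance_curvature L c i"
proof -
  let ?w = "effective_resistance L c" and ?v = "potential L c j i"
  have ji: "(j, i) \<in> L\<^sup>*" "j \<noteq> i" using link_sym[OF G ij] no_loop[OF G] ij by auto
  have "(\<Sum>k | (i, k) \<in> L. c i k * (?w k i + ?w i j - ?w k j))
      = 2 * (\<Sum>k | (i, k) \<in> L. c i k * (?v $ k - ?v $ i))"
    unfolding effective_resistance_gromov_product[OF G] sum_distrib_left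
    by (intro sum.cong) (simp_all only: mult.left_commute)
  also have "\<dots> = - 2 * (laplacian L c *v ?v) $ i"
    unfolding laplacian_mult_nth[OF G]
    by (simp add: sum_distrib_left flip: sum_negf) (simp add: algebra_simps)
  also have "\<dots> = 2" using ji by (simp add: laplacian_potential[OF G] axis_def)
  finally have "(\<Sum>k | (i, k) \<in> L. c i k * ?w k i) + weighted_degree L c i * ?w i j
      - (\<Sum>k | (i, k) \<in> L. c i k * ?w k j) = 2"
    by (simp add: weighted_degree_def sum_distrib_right distrib_left right_diff_distrib sum_subtractf sum.distrib)
  then show ?thesis
    by (simp add: node_resistance_curvature_def effective_resistance_commute[of L c i])
qed

text \<open>All current from \<open>y\<close> to \<open>j\<close> flows outside \<open>A\<close>, so the potential is constant on \<open>A\<close> with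
  the value that it has at \<open>j\<close>. The truncation that proves this vanishes outside \<open>A\<close>: the only
  link that leaves \<open>A\<close> ends in \<open>j\<close>, where the shifted potential vanishes as well.\<close>

lemma effective_resistance_additive_across_link:
  assumes G: "weighted_graph L c"
    and i: "i \<in> A" and j: "j \<notin> A"
    and boundary: "\<And>a b. (a, b) \<in> L \<Longrightarrow> a \<in> A \<Longrightarrow> b \<notin> A \<Longrightarrow> a = i \<and> b = j"
    and x: "x \<in> A" "(x, j) \<in> L\<^sup>*" and y: "y \<notin> A" "(y, j) \<in> L\<^sup>*"
  shows "effective_resistance L c x y = effective_resistance L c x j + effective_resistance L c j y"
proof -
  let ?v = "potential L c y j"
  define h :: "real^'a" where "h = (\<chi> x. if x \<in> A then ?v $ x - ?v $ j else 0)"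
  have "h $ x = h $ j"
  proof (rule dominated_potential_constant[OF G y(2) x(2)])
    fix a b assume ab: "(a, b) \<in> L"
    then have ba: "(b, a) \<in> L" by (rule link_sym[OF G])
    show "(h $ a - h $ b)\<^sup>2 \<le> (h $ a - h $ b) * (?v $ a - ?v $ b)"
      using boundary[OF ab] boundary[OF ba] j by (auto simp: h_def power2_eq_square)
  qed (use y j in \<open>simp add: h_def\<close>)
  then show ?thesis
    using effective_resistance_gromov_product[OF G, of x j y] x j by (simp add: h_def)
qed

section \<open>Transport between distributions\<close>

lemma wasserstein1_le:
  assumes "P \<in> couplings C \<mu> \<nu>"
  shows "wasserstein1 C d \<mu> \<nu> \<le> transport_cost C d P"
  using wasserstein1_attained[of C \<mu> \<nu> d] assms by force

lemma transport_cost_potential: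
  assumes "P \<in> couplings C \<mu> \<nu>"
  shows "transport_cost C (\<lambda>x y. f x - f y) P = (\<Sum>x\<in>C. \<mu> $ x * f x) - (\<Sum>y\<in>C. \<nu> $ y * f y)"
proof -
  have "(\<Sum>x\<in>C. \<Sum>y\<in>C. P $ x $ y * f x) = (\<Sum>x\<in>C. \<mu> $ x * f x)"
    using assms by (simp add: couplings_def flip: sum_distrib_right)
  moreover have "(\<Sum>x\<in>C. \<Sum>y\<in>C. P $ x $ y * f y) = (\<Sum>y\<in>C. \<nu> $ y * f y)"
    using assms by (subst sum.swap) (simp add: couplings_def flip: sum_distrib_right)
  ultimately show ?thesis
    by (simp add: transport_cost_def right_diff_distrib sum_subtractf)
qed

text \<open>Weak duality. For the cost \<open>f x - f y\<close> all couplings cost the same, so an arbitrary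
  coupling \<open>P\<close> evaluates the dual functional.\<close>

lemma wasserstein1_ge_potential:
  assumes P: "P \<in> couplings C \<mu> \<nu>"
    and lip: "\<And>x y. x \<in> C \<Longrightarrow> y \<in> C \<Longrightarrow> f x - f y \<le> d x y"
  shows "transport_cost C (\<lambda>x y. f x - f y) P \<le> wasserstein1 C d \<mu> \<nu>"
proof -
  obtain R where R: "R \<in> couplings C \<mu> \<nu>" "transport_cost C d R = wasserstein1 C d \<mu> \<nu>"
    using wasserstein1_attained[of C \<mu> \<nu> d] P by blast
  have "transport_cost C (\<lambda>x y. f x - f y) P = transport_cost C (\<lambda>x y. f x - f y) R"
    by (simp add: transport_cost_potential[OF P] transport_cost_potential[OF R(1)])
  also have "\<dots> \<le> transport_cost C d R"
    using R(1) lip unfolding transport_cost_def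
    by (intro sum_mono mult_left_mono) (auto simp: couplings_def)
  finally show ?thesis using R(2) by simp
qed

lemma wasserstein1_convex:
  assumes ne: "couplings C \<mu> \<nu> \<noteq> {}" "couplings C \<mu>' \<nu>' \<noteq> {}" and s: "0 \<le> s" "s \<le> 1"
  shows "wasserstein1 C d ((1 - s) *\<^sub>R \<mu> + s *\<^sub>R \<mu>') ((1 - s) *\<^sub>R \<nu> + s *\<^sub>R \<nu>')
    \<le> (1 - s) * wasserstein1 C d \<mu> \<nu> + s * wasserstein1 C d \<mu>' \<nu>'"
proof -
  obtain P where P: "P \<in> couplings C \<mu> \<nu>" "transport_cost C d P = wasserstein1 C d \<mu> \<nu>"
    using wasserstein1_attained[OF ne(1)] by blast
  obtain R where R: "R \<in> couplings C \<mu>' \<nu>'" "transport_cost C d R = wasserstein1 C d \<mu>' \<nu>'"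
    using wasserstein1_attained[OF ne(2)] by blast
  have "(1 - s) *\<^sub>R P + s *\<^sub>R R
      \<in> couplings C ((1 - s) *\<^sub>R \<mu> + s *\<^sub>R \<mu>') ((1 - s) *\<^sub>R \<nu> + s *\<^sub>R \<nu>')"
    using P(1) R(1) s by (auto simp: couplings_def sum.distrib simp flip: sum_distrib_left)
  from wasserstein1_le[OF this, of d] show ?thesis
    unfolding P(2)[symmetric] R(2)[symmetric] transport_cost_def
    by (simp add: sum.distrib distrib_right sum_distrib_left mult.assoc)
qed

section \<open>The transport plan between neighbouring walks\<close>

text \<open>The three summands are nested conditionals over one variable at a time, so that sums over
  either variable collapse by simplification. Since \<open>j\<close> is a
  neighbour of \<open>i\<close> and conversely, some mass at \<open>j\<close> and some mass at \<open>i\<close> stays in place.\<close>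

definition neighbour_plan ::
    "('n::finite \<times> 'n) set \<Rightarrow> ('n \<Rightarrow> 'n \<Rightarrow> real) \<Rightarrow> 'n \<Rightarrow> 'n \<Rightarrow> real \<Rightarrow> real^'n^'n" where
  "neighbour_plan L c i j t = (\<chi> x y.
     (if y = j then if (i, x) \<in> L then t * c i x else 0 else 0)
   + (if x = i then if (j, y) \<in> L then t * c j y else 0 else 0)
   + (if x = i then if y = j then 1 - t * weighted_degree L c i - t * weighted_degree L c j else 0 else 0))"

lemma component_of_link:
  assumes "weighted_graph L c" and "(i, j) \<in> L"
  shows "i \<in> component_of L i" "j \<in> component_of L i"
    and "{k. (i, k) \<in> L} \<subseteq> component_of L i" "{l. (j, l) \<in> L} \<subseteq> component_of L i"
  using assms
  by (auto simp: component_of_def intro: rtrancl_into_rtrancl[OF r_into_rtrancl])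

lemma sum_links_in:
  fixes C :: "'n::finite set"
  assumes "{k. (i, k) \<in> L} \<subseteq> C"
  shows "(\<Sum>x\<in>C. if (i, x) \<in> L then g x else (0::real)) = (\<Sum>k | (i, k) \<in> L. g k)"
  using assms by (simp add: sum.If_cases Int_absorb1)

text \<open>The cost function is arbitrary, so that the formula applies both to the resistance and to the
  differences \<open>f x - f y\<close> in the duality bound.\<close>

lemma transport_cost_neighbour_plan:
  assumes G: "weighted_graph L c" and ij: "(i, j) \<in> L"
  shows "transport_cost (component_of L i) d (neighbour_plan L c i j t) =
    d i j + t * ((\<Sum>k | (i, k) \<in> L. c i k * d k j) + (\<Sum>l | (j, l) \<in> L. c j l * d i l)
      - (weighted_degree L c i + weighted_degree L c j) * d i j)"
proof -
  let ?C = "component_of L i"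
  note C = component_of_link[OF G ij]
  have "transport_cost ?C d (neighbour_plan L c i j t) =
     (\<Sum>x\<in>?C. \<Sum>y\<in>?C. if y = j then (if (i, x) \<in> L then t * c i x * d x j else 0) else 0)
   + (\<Sum>x\<in>?C. \<Sum>y\<in>?C. if x = i then (if (j, y) \<in> L then t * c j y * d i y else 0) else 0)
   + (\<Sum>x\<in>?C. \<Sum>y\<in>?C. if y = j then (if x = i then
        (1 - t * weighted_degree L c i - t * weighted_degree L c j) * d i j else 0) else 0)"
    unfolding transport_cost_def neighbour_plan_def sum.distrib[symmetric]
    by (intro sum.cong) (auto simp: distrib_right)
  also have "(\<Sum>x\<in>?C. \<Sum>y\<in>?C. if x = i then (if (j, y) \<in> L then t * c j y * d i y else 0) else 0)
     = (\<Sum>y\<in>?C. \<Sum>x\<in>?C. if x = i then (if (j, y) \<in> L then t * c j y * d i y else 0) else 0)"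
    by (rule sum.swap)
  finally show ?thesis
    using C by (simp add: sum_links_in sum_distrib_left algebra_simps)
qed

text \<open>The bound on \<open>t\<close> keeps the mass that moves from \<open>i\<close> to \<open>j\<close> nonnegative.\<close>

lemma neighbour_plan_coupling:
  assumes G: "weighted_graph L c" and ij: "(i, j) \<in> L"
    and t: "0 \<le> t" "t * (weighted_degree L c i + weighted_degree L c j) \<le> 1"
  shows "neighbour_plan L c i j t \<in> couplings (component_of L i) (lazy_walk L c t i) (lazy_walk L c t j)"
proof -
  let ?C = "component_of L i"
  note C = component_of_link[OF G ij]
  have sym: "(x, y) \<in> L \<longleftrightarrow> (y, x) \<in> L" "(x, y) \<in> L \<Longrightarrow> c x y = c y x" "(x, x) \<notin> L"
     "(x, y) \<in> L \<Longrightarrow> 0 < c x y" for x y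
    using link_sym[OF G] weight_commute[OF G] no_loop[OF G] weight_pos[OF G] by blast+
  have nn: "0 \<le> neighbour_plan L c i j t $ x $ y" for x y
    using t sym(4) less_imp_le[OF sym(4)]
    by (auto simp: neighbour_plan_def distrib_left intro!: add_nonneg_nonneg mult_nonneg_nonneg)
  have row: "(\<Sum>y\<in>?C. neighbour_plan L c i j t $ x $ y) = lazy_walk L c t i $ x" if "x \<in> ?C" for x
    using C sym(1)[of x i] sym(2)[of x i] sym(3)
    by (auto simp: neighbour_plan_def sum.distrib lazy_walk_nth[OF G] sum_links_in weighted_degree_def
      simp flip: sum_distrib_left)
  have col: "(\<Sum>x\<in>?C. neighbour_plan L c i j t $ x $ y) = lazy_walk L c t j $ y" if "y \<in> ?C" for y
    using C sym(1)[of y j] sym(2)[of y j] sym(3)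
    by (auto simp: neighbour_plan_def sum.distrib lazy_walk_nth[OF G] sum_links_in weighted_degree_def
      simp flip: sum_distrib_left)
  show ?thesis using nn row col by (simp add: couplings_def)
qed

lemma resistance_cost_neighbour_plan:
  assumes G: "weighted_graph L c" and ij: "(i, j) \<in> L"
  shows "transport_cost (component_of L i) (effective_resistance L c) (neighbour_plan L c i j t) =
    effective_resistance L c i j
      - 2 * t * (node_resistance_curvature L c i + node_resistance_curvature L c j)"
proof -
  have ji: "(j, i) \<in> L" using G ij by (rule link_sym)
  have other: "(\<Sum>l | (j, l) \<in> L. c j l * effective_resistance L c i l)
      = weighted_degree L c j * effective_resistance L c i j - 2 * node_resistance_curvature L c j"
    using effective_resistance_weighted_sum[OF G ji] by (simp add: effective_resistance_commute[of L c i])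
  show ?thesis
    unfolding transport_cost_neighbour_plan[OF G ij] effective_resistance_weighted_sum[OF G ij] other
    by (simp add: algebra_simps)
qed

section \<open>The Ollivier--Ricci quotient for small times\<close>

lemma antimono_bounded_tendsto_at_right:
  fixes q :: "real \<Rightarrow> real"
  assumes T: "0 < T"
    and anti: "\<And>s t. 0 < s \<Longrightarrow> s \<le> t \<Longrightarrow> t \<le> T \<Longrightarrow> q t \<le> q s"
    and bound: "\<And>t. 0 < t \<Longrightarrow> t \<le> T \<Longrightarrow> q t \<le> K"
  shows "\<exists>l. (q \<longlongrightarrow> l) (at_right 0)"
proof -
  define l where "l = (SUP t\<in>{0<..T}. q t)"
  have bdd: "bdd_above (q ` {0<..T})" using bound by (auto intro!: bdd_aboveI2)
  have near: "eventually (\<lambda>t. 0 < t \<and> t \<le> s) (at_right 0)" if "0 < s" for s :: real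
    using that by (auto simp: eventually_at_right intro: exI[of _ s])
  have "(q \<longlongrightarrow> l) (at_right 0)"
  proof (rule order_tendstoI)
    fix a assume "a < l"
    then obtain s where s: "0 < s" "s \<le> T" "a < q s"
      unfolding l_def using T bdd by (subst (asm) less_cSUP_iff) auto
    show "eventually (\<lambda>t. a < q t) (at_right 0)"
      using near[OF s(1)] by eventually_elim (use s anti in \<open>force intro: less_le_trans\<close>)
  next
    fix a assume "l < a"
    show "eventually (\<lambda>t. q t < a) (at_right 0)"
      using near[OF T]
    proof eventually_elim
      case (elim t)
      then have "q t \<le> l" unfolding l_def using bdd by (intro cSUP_upper) auto
      then show ?case using \<open>l < a\<close> by simp
    qed
  qed
  then show ?thesis ..
qed

lemma lazy_walk_affine:
  "lazy_walk L c (s * t) i = (1 - s) *\<^sub>R lazy_walk L c 0 i + s *\<^sub>R lazy_walk L c t i"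
proof -
  have "lazy_walk L c u i = axis i 1 - u *\<^sub>R (laplacian L c *v axis i 1)" for u
    unfolding lazy_walk_def matrix_vector_mult_diff_rdistrib scaleR_matrix_vector_assoc[symmetric]
    by simp
  then show ?thesis by (simp add: scaleR_diff_right scaleR_diff_left)
qed

lemma weighted_degree_pos:
  assumes G: "weighted_graph L c" and ij: "(i, j) \<in> L"
  shows "0 < weighted_degree L c i"
  unfolding weighted_degree_def
  using ij by (intro sum_pos) (auto dest: weight_pos[OF G])

lemma ollivier_ricci_quotient_le_iff:
  assumes G: "weighted_graph L c" and ij: "(i, j) \<in> L" and t: "0 < t"
  shows "ollivier_ricci_quotient L c i j t \<le> r / effective_resistance L c i j \<longleftrightarrow>
      effective_resistance L c i j - t * r \<le> wasserstein1 (component_of L i) (effective_resistance L c)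
        (lazy_walk L c t i) (lazy_walk L c t j)"
    and "r / effective_resistance L c i j \<le> ollivier_ricci_quotient L c i j t \<longleftrightarrow>
      wasserstein1 (component_of L i) (effective_resistance L c)
        (lazy_walk L c t i) (lazy_walk L c t j) \<le> effective_resistance L c i j - t * r"
proof -
  let ?w = "effective_resistance L c i j"
  let ?W = "wasserstein1 (component_of L i) (effective_resistance L c)
    (lazy_walk L c t i) (lazy_walk L c t j)"
  have w: "0 < ?w" using no_loop[OF G] ij by (intro effective_resistance_pos[OF G]) auto
  have q: "ollivier_ricci_quotient L c i j t = ((?w - ?W) / t) / ?w"
    using w by (simp add: ollivier_ricci_quotient_def diff_divide_distrib)
  show "ollivier_ricci_quotient L c i j t \<le> r / ?w \<longleftrightarrow> ?w - t * r \<le> ?W"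
    unfolding q divide_le_cancel using w t by (auto simp: pos_divide_le_eq algebra_simps)
  show "r / ?w \<le> ollivier_ricci_quotient L c i j t \<longleftrightarrow> ?W \<le> ?w - t * r"
    unfolding q divide_le_cancel using w t by (auto simp: pos_le_divide_eq algebra_simps)
qed

text \<open>Convexity of the distance along the segment from time \<open>0\<close> to time \<open>t\<close>, and the value
  \<open>\<omega> i j\<close> of the plan at time \<open>0\<close>.\<close>

lemma ollivier_ricci_quotient_antimono:
  assumes G: "weighted_graph L c" and ij: "(i, j) \<in> L" and s: "0 < s" "s \<le> t"
    and t: "t * (weighted_degree L c i + weighted_degree L c j) \<le> 1"
  shows "ollivier_ricci_quotient L c i j t \<le> ollivier_ricci_quotient L c i j s"
proof -
  let ?w = "effective_resistance L c i j"
  let ?W = "\<lambda>t. wasserstein1 (component_of L i) (effective_resistance L c)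
    (lazy_walk L c t i) (lazy_walk L c t j)"
  have w: "0 < ?w" using no_loop[OF G] ij by (intro effective_resistance_pos[OF G]) auto
  have t0: "0 < t" using s by simp
  define r where "r = s / t"
  have r: "0 < r" "r \<le> 1" "s = r * t" using s t0 by (auto simp: r_def)
  have plan0: "neighbour_plan L c i j 0 \<in> couplings (component_of L i) (lazy_walk L c 0 i) (lazy_walk L c 0 j)"
    and plan: "neighbour_plan L c i j t \<in> couplings (component_of L i) (lazy_walk L c t i) (lazy_walk L c t j)"
    using t t0 by (auto intro: neighbour_plan_coupling[OF G ij])
  have W0: "?W 0 \<le> ?w"
    using wasserstein1_le[OF plan0, of "effective_resistance L c"]
    by (simp add: resistance_cost_neighbour_plan[OF G ij])
  have "?W s \<le> (1 - r) * ?W 0 + r * ?W t"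
    unfolding r(3) lazy_walk_affine using plan0 plan r(1,2) by (intro wasserstein1_convex) auto
  also have "\<dots> \<le> (1 - r) * ?w + r * ?W t"
    using W0 r by (simp add: mult_left_mono)
  finally have "r * (?w - ?W t) \<le> ?w - ?W s" by (simp add: algebra_simps)
  then have "r * (?w - ?W t) / (s * ?w) \<le> (?w - ?W s) / (s * ?w)"
    using w s by (intro divide_right_mono) auto
  moreover have "ollivier_ricci_quotient L c i j u = (?w - ?W u) / (u * ?w)" for u
    using w by (simp add: ollivier_ricci_quotient_def diff_divide_distrib right_diff_distrib)
  moreover have "r * (?w - ?W t) / (s * ?w) = (?w - ?W t) / (t * ?w)"
    using r by simp
  ultimately show ?thesis by simp
qed

lemma ollivier_ricci_quotient_ge:
  assumes G: "weighted_graph L c" and ij: "(i, j) \<in> L" and t: "0 < t"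
    "t * (weighted_degree L c i + weighted_degree L c j) \<le> 1"
  shows "link_resistance_curvature L c i j \<le> ollivier_ricci_quotient L c i j t"
proof -
  show ?thesis
    unfolding link_resistance_curvature_def ollivier_ricci_quotient_le_iff(2)[OF G ij t(1)]
    using wasserstein1_le[OF neighbour_plan_coupling[OF G ij], of t "effective_resistance L c"] t
    by (simp add: resistance_cost_neighbour_plan[OF G ij] mult_ac)
qed

text \<open>Evaluating the dual functional on the neighbour plan makes it affine in \<open>t\<close>, so the bound
  does not depend on \<open>t\<close>.\<close>

lemma ollivier_ricci_quotient_le:
  assumes G: "weighted_graph L c" and ij: "(i, j) \<in> L" and t: "0 < t"
    "t * (weighted_degree L c i + weighted_degree L c j) \<le> 1"
    and lip: "\<And>x y. x \<in> component_of L i \<Longrightarrow> y \<in> component_of L i \<Longrightarrow> f x - f y \<le> effective_resistance L c x y"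
    and f: "f i - f j = effective_resistance L c i j"
  shows "ollivier_ricci_quotient L c i j t \<le>
    ((weighted_degree L c i + weighted_degree L c j) * effective_resistance L c i j
      - (\<Sum>k | (i, k) \<in> L. c i k * (f k - f j)) - (\<Sum>l | (j, l) \<in> L. c j l * (f i - f l)))
    / effective_resistance L c i j"
  unfolding ollivier_ricci_quotient_le_iff(1)[OF G ij t(1)]
  using wasserstein1_ge_potential[OF neighbour_plan_coupling[OF G ij], of t f "effective_resistance L c"] t lip
  unfolding transport_cost_neighbour_plan[OF G ij] f
  by (simp add: right_diff_distrib distrib_left)

section \<open>Cut links\<close>

text \<open>If \<open>i\<close> and \<open>j\<close> stayed connected, the removed link could be replaced by a path in every walk,
  and the components would be the same.\<close>

lemma cut_link_separates:
  assumes G: "weighted_graph L c" and cut: "cut_link L i j"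
  shows "(i, j) \<notin> (L - {(i, j), (j, i)})\<^sup>*"
proof
  let ?L = "L - {(i, j), (j, i)}"
  assume ij: "(i, j) \<in> ?L\<^sup>*"
  have "sym ?L" using link_sym[OF G] by (auto simp: sym_def)
  then have "(j, i) \<in> ?L\<^sup>*" using ij by (meson sym_rtrancl symD)
  with ij have "L \<subseteq> ?L\<^sup>*" by auto
  then have "?L\<^sup>* = L\<^sup>*" by (metis Diff_subset rtrancl_subset)
  then show False using cut by (simp add: cut_link_def num_components_def component_of_def[abs_def])
qed

text \<open>A Kantorovich potential for the neighbour plan: the three equations say that it is tight on the
  pairs that carry mass.\<close>

lemma cut_link_potential:
  assumes G: "weighted_graph L c" and ij: "(i, j) \<in> L" and cut: "cut_link L i j"
  obtains f where
    "\<And>x y. x \<in> component_of L i \<Longrightarrow> y \<in> component_of L i \<Longrightarrow> f x - f y \<le> effective_resistance L c x y"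
    "f i - f j = effective_resistance L c i j"
    "\<And>k. (i, k) \<in> L \<Longrightarrow> f k - f j = effective_resistance L c k j"
    "\<And>l. (j, l) \<in> L \<Longrightarrow> f i - f l = effective_resistance L c i l"
proof -
  let ?w = "effective_resistance L c"
  define A where "A = component_of (L - {(i, j), (j, i)}) i"
  define f where "f x = (if x \<in> A then ?w x j else - ?w j x)" for x
  have symL: "(y, x) \<in> L" if "(x, y) \<in> L" for x y
    using that by (rule link_sym[OF G])
  have i: "i \<in> A" by (simp add: A_def component_of_def)
  have j: "j \<notin> A" using cut_link_separates[OF G cut] by (simp add: A_def component_of_def)
  have boundary: "a = i \<and> b = j" if "(a, b) \<in> L" "a \<in> A" "b \<notin> A" for a b
  proof -
    have "(a, b) \<notin> L - {(i, j), (j, i)}"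
      using that by (auto simp: A_def component_of_def dest: rtrancl_into_rtrancl)
    then show ?thesis using that i j by auto
  qed
  note conn = connected_in_component[OF G, of _ i]
  note C = component_of_link[OF G ij]
  have split: "?w x y = ?w x j + ?w j y"
    if "x \<in> A" "y \<notin> A" "x \<in> component_of L i" "y \<in> component_of L i" for x y
    using that conn C(2)
    by (intro effective_resistance_additive_across_link[OF G i j boundary]) auto
  show thesis
  proof (rule that[of f])
    fix x y assume xy: "x \<in> component_of L i" "y \<in> component_of L i"
    note tri = effective_resistance_triangle[OF G] and nn = effective_resistance_nonneg[OF G]
    show "f x - f y \<le> ?w x y"
    proof (cases "x \<in> A"; cases "y \<in> A")
      assume "x \<in> A" "y \<in> A"
      then show ?thesis using tri[of j y x] conn xy C by (simp add: f_def)
    next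
      assume "x \<in> A" "y \<notin> A"
      then show ?thesis using split xy by (simp add: f_def)
    next
      assume "x \<notin> A" "y \<in> A"
      then show ?thesis using nn[of x y] nn[of j x] nn[of y j] conn xy C by (simp add: f_def)
    next
      assume "x \<notin> A" "y \<notin> A"
      then show ?thesis using tri[of y x j] conn xy C by (simp add: f_def)
    qed
  next
    show "f i - f j = ?w i j" using i j by (simp add: f_def)
  next
    fix k assume k: "(i, k) \<in> L"
    then show "f k - f j = ?w k j" using boundary[OF k i] j by (auto simp: f_def)
  next
    fix l assume l: "(j, l) \<in> L"
    then have "l \<in> component_of L i" using C by auto
    then show "f i - f l = ?w i l"
      using boundary[OF symL[OF l]] i j split[of i l] C by (auto simp: f_def)
  qed
qed

lemma ollivier_ricci_quotient_cut_link:
  assumes G: "weighted_graph L c" and ij: "(i, j) \<in> L" and t: "0 < t"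
    "t * (weighted_degree L c i + weighted_degree L c j) \<le> 1"
    and cut: "cut_link L i j"
  shows "ollivier_ricci_quotient L c i j t = link_resistance_curvature L c i j"
proof (rule antisym[OF _ ollivier_ricci_quotient_ge[OF G ij t]])
  let ?w = "effective_resistance L c"
  obtain f where f:
    "\<And>x y. x \<in> component_of L i \<Longrightarrow> y \<in> component_of L i \<Longrightarrow> f x - f y \<le> ?w x y"
    "f i - f j = ?w i j"
    "\<And>k. (i, k) \<in> L \<Longrightarrow> f k - f j = ?w k j"
    "\<And>l. (j, l) \<in> L \<Longrightarrow> f i - f l = ?w i l"
    using cut_link_potential[OF G ij cut] by blast
  have ji: "(j, i) \<in> L" using G ij by (rule link_sym)
  show "ollivier_ricci_quotient L c i j t \<le> link_resistance_curvature L c i j"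
    using ollivier_ricci_quotient_le[OF G ij t f(1,2)]
      effective_resistance_weighted_sum[OF G ij] effective_resistance_weighted_sum[OF G ji]
    by (simp add: f(3,4) link_resistance_curvature_def effective_resistance_commute[of L c i] algebra_simps)
qed

section \<open>Comparison of the two curvatures\<close>

theorem proposition2:
  fixes L :: "('n::finite \<times> 'n) set" and c :: "'n \<Rightarrow> 'n \<Rightarrow> real" and i j :: 'n
  assumes "weighted_graph L c" and "(i, j) \<in> L"
  shows "(ollivier_ricci_quotient L c i j \<longlongrightarrow> ollivier_ricci_curvature L c i j) (at_right 0)
    \<and> ollivier_ricci_curvature L c i j \<ge> link_resistance_curvature L c i j
    \<and> (cut_link L i j \<longrightarrow> ollivier_ricci_curvature L c i j = link_resistance_curvature L c i j)"
proof -
  note G = assms(1) and ij = assms(2)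
  let ?q = "ollivier_ricci_quotient L c i j" and ?k = "weighted_degree L c i + weighted_degree L c j"
  have ji: "(j, i) \<in> L" using G ij by (rule link_sym)
  have k: "0 < ?k" using weighted_degree_pos[OF G ij] weighted_degree_pos[OF G ji] by simp
  have small: "t * ?k \<le> 1" if "t \<le> 1 / ?k" for t using that k by (simp add: field_simps)
  note conn = connected_in_component[OF G, of _ i]
  \<comment> \<open>The distance to \<open>j\<close> as dual function bounds the quotient as \<open>t\<close> tends to \<open>0\<close>.\<close>
  have lip: "effective_resistance L c x j - effective_resistance L c y j \<le> effective_resistance L c x y"
    if "x \<in> component_of L i" "y \<in> component_of L i" for x y
    using effective_resistance_triangle[OF G, of j y x] conn that component_of_link[OF G ij] by simp
  note bound = ollivier_ricci_quotient_le[OF G ij _ _ lip, simplified]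
  have "\<exists>l. (?q \<longlongrightarrow> l) (at_right 0)"
    by (rule antimono_bounded_tendsto_at_right[of "1 / ?k"])
      (use k small bound ollivier_ricci_quotient_antimono[OF G ij] in auto)
  then obtain l where l: "(?q \<longlongrightarrow> l) (at_right 0)" ..
  have curv: "ollivier_ricci_curvature L c i j = l"
    unfolding ollivier_ricci_curvature_def by (rule tendsto_Lim[OF _ l]) simp
  \<comment> \<open>The range of \<open>t\<close> on which the neighbour plan is a coupling.\<close>
  have near: "eventually (\<lambda>t. 0 < t \<and> t * ?k \<le> 1) (at_right 0)"
    using k small by (auto simp: eventually_at_right intro!: exI[of _ "1 / ?k"])
  have "link_resistance_curvature L c i j \<le> l"
    by (rule tendsto_lowerbound[OF l]) (use near ollivier_ricci_quotient_ge[OF G ij] in \<open>auto elim: eventually_mono\<close>)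
  moreover have "l = link_resistance_curvature L c i j" if "cut_link L i j"
  proof (rule tendsto_unique[OF _ l])
    show "(?q \<longlongrightarrow> link_resistance_curvature L c i j) (at_right 0)"
      by (rule tendsto_eventually)
        (use near ollivier_ricci_quotient_cut_link[OF G ij _ _ that] in \<open>auto elim: eventually_mono\<close>)
  qed simp
  ultimately show ?thesis using curv l by simp
qed

end
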